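(* Let $\Sigma$ be a signed graph with $n$ vertices and at least one positive edge. Let $\lambda_1(\Sigma_+)\ge\lambda_2(\Sigma_+)\ge\cdots\ge\lambda_n(\Sigma_+)$ be the eigenvalues of $A(\Sigma_+)$. Then \[\chi(\Sigma)\ge 1+\max_{m=1,2,\dots,n-1}\frac{\sum_{i=1}^m\lambda_i(\Sigma_+)}{-\sum_{i=1}^m\lambda_{n-i+1}(\Sigma_+)}.\]
   Context: A signed graph $\Sigma=(G,\sigma)$ is a finite simple graph $G=(V,E)$ with a sign function $\sigma:E\to\{-1,+1\}$. $\Sigma_+$ is the spanning subgraph of $\Sigma$ (vertex set $V$) whose edges are exactly the positive edges. The adjacency matrix of a signed graph has $(i,j)$ entry equal to the sign of the edge $v_iv_j$ if $v_i\sim v_j$ and $0$ otherwise. For $k\ge1$ let $M_k=\{\pm1,\pm2,\dots,\pm k/2\}$ if $k$ is even and $M_k=\{0,\pm1,\dots,\pm(k-1)/2\}$ if $k$ is odd. A (proper) $k$-coloring of $\Sigma$ is a map $c:V\to M_k$ with $c(u)\ne\sigma(uv)c(v)$ for every edge $uv\in E$. The signed chromatic number $\chi(\Sigma)$ is the minimum $k$ for which $\Sigma$ admits a $k$-coloring. *)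

theory Defs
  imports Complex_Main "HOL-Library.FuncSet" "Jordan_Normal_Form.Char_Poly"
begin

text \<open>Edges are two-element sets of vertices; the values of \<open>edge_sign\<close> outside
  \<open>edges\<close> are irrelevant.\<close>

record 'v sgraph =
  verts :: "'v set"
  edges :: "'v set set"
  edge_sign :: "'v set \<Rightarrow> int"

definition signed_graph :: "'v sgraph \<Rightarrow> bool" where
  "signed_graph S \<longleftrightarrow>
     finite (verts S) \<and>
     (\<forall>e \<in> edges S. e \<subseteq> verts S \<and> card e = 2) \<and>
     edge_sign S ` edges S \<subseteq> {-1, 1}"

definition positive_part :: "'v sgraph \<Rightarrow> 'v sgraph" where
  "positive_part S = S\<lparr>edges := {e \<in> edges S. edge_sign S e = 1}\<rparr>"

text \<open>The list \<open>vs\<close> is the enumeration of the vertices that indexes rows and columns.\<close>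

definition adj_matrix :: "'v sgraph \<Rightarrow> 'v list \<Rightarrow> real mat" where
  "adj_matrix S vs = mat (length vs) (length vs)
     (\<lambda>(i, j). if {vs ! i, vs ! j} \<in> edges S
               then real_of_int (edge_sign S {vs ! i, vs ! j}) else 0)"

text \<open>The \<open>i\<close>-th largest eigenvalue (\<open>i = 1, \<dots>, n\<close>), counted with algebraic multiplicity.
  It is only used for symmetric matrices, whose characteristic polynomials have all their
  roots in the reals, so that the list below has length \<open>n\<close>.\<close>

definition eigval :: "real mat \<Rightarrow> nat \<Rightarrow> real" where
  "eigval A i = rev (sorted_list_of_multiset (proots (char_poly A))) ! (i - 1)"

definition color_set :: "nat \<Rightarrow> int set" where
  "color_set k =
     (if even k then {- int (k div 2) .. int (k div 2)} - {0}
      else {- int ((k - 1) div 2) .. int ((k - 1) div 2)})"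

definition proper_coloring :: "'v sgraph \<Rightarrow> nat \<Rightarrow> ('v \<Rightarrow> int) \<Rightarrow> bool" where
  "proper_coloring S k c \<longleftrightarrow>
     c \<in> verts S \<rightarrow> color_set k \<and>
     (\<forall>u v. {u, v} \<in> edges S \<longrightarrow> c u \<noteq> edge_sign S {u, v} * c v)"

definition signed_chromatic_number :: "'v sgraph \<Rightarrow> nat" where
  "signed_chromatic_number S = (LEAST k. k \<ge> 1 \<and> (\<exists>c. proper_coloring S k c))"

text \<open>The minimum in the previous definition is attained.\<close>

lemma ex_proper_coloring:
  assumes "signed_graph S"
  shows "\<exists>k\<ge>1. \<exists>c. proper_coloring S k c"
proof -
  define n where "n = card (verts S)"
  from assms have fin: "finite (verts S)" by (simp add: signed_graph_def)
  then obtain f where f: "bij_betw f (verts S) {0..<n}"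
    unfolding n_def using ex_bij_betw_finite_nat by blast
  define c where "c v = int (f v) + 1" for v
  have "proper_coloring S (2 * (n + 1)) c"
    unfolding proper_coloring_def
  proof (intro conjI allI impI)
    show "c \<in> verts S \<rightarrow> color_set (2 * (n + 1))"
    proof
      fix v assume "v \<in> verts S"
      with f have "f v < n" by (auto simp: bij_betw_def)
      then show "c v \<in> color_set (2 * (n + 1))" by (simp add: color_set_def c_def)
    qed
  next
    fix u v assume e: "{u, v} \<in> edges S"
    with assms have uv: "u \<in> verts S" "v \<in> verts S" "card {u, v} = 2"
      and s: "edge_sign S {u, v} \<in> {-1, 1}"
      by (auto simp: signed_graph_def)
    from uv(3) have "u \<noteq> v" by auto
    with uv f have "f u \<noteq> f v" by (auto simp: bij_betw_def inj_on_def)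
    with s show "c u \<noteq> edge_sign S {u, v} * c v" by (auto simp: c_def)
  qed
  moreover have "2 * (n + 1) \<ge> 1" by simp
  ultimately show ?thesis by blast
qed

end

theory Submission
  imports Defs "Jordan_Normal_Form.Schur_Decomposition" "HOL-Analysis.Convex"
begin

text \<open>
  A proper \<open>k\<close>-coloring of a signed graph gives different colors to the ends of every positive
  edge, and there are \<open>k\<close> colors. So the adjacency matrix \<open>A\<close> of the positive part vanishes on
  every pair of vertices of equal color, and it suffices to bound the eigenvalues of a symmetric
  matrix with this property.

  Let \<open>f\<^sub>1, \<dots>, f\<^sub>n\<close> be an orthonormal eigenbasis for the eigenvalues
  \<open>\<lambda>\<^sub>1 \<ge> \<dots> \<ge> \<lambda>\<^sub>n\<close>, and write \<open>s\<^sub>i\<^sub>j(a)\<close> for the sum of \<open>f\<^sub>i(x) f\<^sub>j(x)\<close> over the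
  vertices \<open>x\<close> of color \<open>a\<close>. Put
  \<open>q\<^sub>i\<^sub>j = k (\<Sum>a. s\<^sub>i\<^sub>j(a)\<^sup>2) - \<delta>\<^sub>i\<^sub>j\<close>. This matrix is symmetric. It is nonnegative by the
  Cauchy-Schwarz inequality over the \<open>k\<close> colors, as \<open>\<Sum>a. s\<^sub>i\<^sub>j(a) = \<delta>\<^sub>i\<^sub>j\<close>.
  Its row sums are \<open>k - 1\<close> by completeness of the basis. Finally, \<open>\<Sum>j. q\<^sub>i\<^sub>j \<lambda>\<^sub>j = - \<lambda>\<^sub>i\<close>, because
  \<open>\<Sum>j. s\<^sub>i\<^sub>j(a)\<^sup>2 \<lambda>\<^sub>j\<close> is the quadratic form of \<open>A\<close> at the restriction of \<open>f\<^sub>i\<close> to the color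
  class \<open>a\<close>, where \<open>A\<close> is zero.

  Hence \<open>- (\<lambda>\<^sub>1 + \<dots> + \<lambda>\<^sub>m) = \<Sum>j. w\<^sub>j \<lambda>\<^sub>j\<close> with weights \<open>w\<^sub>j = \<Sum>i\<le>m. q\<^sub>i\<^sub>j\<close> that lie between
  \<open>0\<close> and \<open>k - 1\<close> and have total \<open>(k - 1) m\<close>. Such a weighted sum is least when all the weight
  sits on the \<open>m\<close> smallest eigenvalues, which gives the key inequality
  \<open>eigval_sums_of_properly_colored_mat\<close>; the theorem is its quotient form. This is a real form of
  the argument that averages \<open>A\<close> over \<open>k\<close> diagonal unitary matrices and applies Ky Fan's
  inequality: \<open>q\<close> collects the squared entries of the \<open>k - 1\<close> nontrivial ones in the eigenbasis.

  The eigenvalues are given as sorted roots of the characteristic polynomial, so the eigenbasis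
  has to come in the same order and with the same multiplicities. This is why the
  diagonalization below starts from an arbitrary ordering of the linear factors of that polynomial.
\<close>

section \<open>Diagonalization of real symmetric matrices\<close>

text \<open>For an eigenvector \<open>v\<close>, the Hermitian form \<open>v\<^sup>* A v\<close> is real by symmetry of \<open>A\<close>, and the
  eigenvalue is its quotient by the squared norm of \<open>v\<close>.\<close>

lemma symmetric_real_mat_eigenvalue_real:
  fixes A :: "real mat"
  assumes A: "A \<in> carrier_mat n n" and sym: "transpose_mat A = A"
    and ev: "eigenvalue (map_mat complex_of_real A) z"
  shows "z \<in> \<real>"
proof -
  define v where "v = (SOME v. eigenvector (map_mat complex_of_real A) v z)"
  from ev have "eigenvector (map_mat complex_of_real A) v z"
    unfolding eigenvalue_def v_def by (rule someI_ex)
  with A have v: "v \<in> carrier_vec n" "v \<noteq> 0\<^sub>v n"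
    and Av: "map_mat complex_of_real A *\<^sub>v v = z \<cdot>\<^sub>v v"
    by (auto simp: eigenvector_def)
  define N where "N = (\<Sum>x<n. (cmod (v $ x))\<^sup>2)"
  have "N \<noteq> 0"
  proof
    assume "N = 0"
    then have "\<forall>x<n. v $ x = 0" unfolding N_def by (subst (asm) sum_nonneg_eq_0_iff) auto
    with v show False by (metis carrier_vecD eq_vecI index_zero_vec)
  qed
  define q where "q = (\<Sum>x<n. \<Sum>y<n. cnj (v $ x) * (of_real (A $$ (x, y)) * v $ y))"
  have sym': "A $$ (x, y) = A $$ (y, x)" if "x < n" "y < n" for x y
    using A that by (metis sym carrier_matD index_transpose_mat(1))
  have "cnj q = (\<Sum>x<n. \<Sum>y<n. cnj (v $ y) * (of_real (A $$ (x, y)) * v $ x))"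
    unfolding q_def by (simp add: algebra_simps)
  also have "\<dots> = (\<Sum>y<n. \<Sum>x<n. cnj (v $ y) * (of_real (A $$ (x, y)) * v $ x))"
    by (rule sum.swap)
  also have "\<dots> = q" unfolding q_def by (intro sum.cong refl) (simp add: sym')
  finally have "q \<in> \<real>" by (simp add: Reals_cnj_iff)
  have row: "(\<Sum>y<n. of_real (A $$ (x, y)) * v $ y) = z * v $ x" if "x < n" for x
    using arg_cong[OF Av, of "\<lambda>u. u $ x"] that A v
    by (simp add: scalar_prod_def row_def lessThan_atLeast0)
  have "q = (\<Sum>x<n. cnj (v $ x) * (z * v $ x))"
    unfolding q_def by (intro sum.cong refl) (simp add: row flip: sum_distrib_left)
  also have "\<dots> = (\<Sum>x<n. z * of_real ((cmod (v $ x))\<^sup>2))"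
    by (intro sum.cong refl, subst complex_norm_square) simp
  also have "\<dots> = z * of_real N"
    by (simp add: N_def sum_distrib_left)
  finally have "z = q / of_real N" using \<open>N \<noteq> 0\<close> by simp
  with \<open>q \<in> \<real>\<close> show ?thesis by simp
qed

text \<open>Over the complex numbers the polynomial splits, and its roots are eigenvalues, hence
  real; the factorization is then pulled back along the embedding of the reals.\<close>

lemma symmetric_real_mat_char_poly_splits:
  fixes A :: "real mat"
  assumes A: "A \<in> carrier_mat n n" and sym: "transpose_mat A = A"
  obtains es where "char_poly A = (\<Prod>a\<leftarrow>es. [:- a, 1:])"
proof -
  interpret map_poly_of_real: map_poly_inj_comm_ring_hom complex_of_real ..
  let ?M = "map_mat complex_of_real A"
  have M: "?M \<in> carrier_mat n n" using A by simp
  from char_poly_factorized[OF M] obtain as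
    where as: "char_poly ?M = (\<Prod>a\<leftarrow>as. [:- a, 1:])" by blast
  have "a \<in> \<real>" if "a \<in> set as" for a
  proof (rule symmetric_real_mat_eigenvalue_real[OF A sym])
    have "poly (char_poly ?M) a = 0"
      unfolding as using that by (force simp: poly_prod_list prod_list_zero_iff image_iff)
    then show "eigenvalue ?M a" using eigenvalue_root_char_poly[OF M] by simp
  qed
  then have "map complex_of_real (map Re as) = as" by (simp add: map_idI)
  then have "map_poly complex_of_real (char_poly A)
      = (\<Prod>a\<leftarrow>map complex_of_real (map Re as). [:- a, 1:])"
    using as of_real_hom.char_poly_hom[OF A] by metis
  also have "\<dots> = map_poly complex_of_real (\<Prod>a\<leftarrow>map Re as. [:- a, 1:])"
    by (simp add: map_poly_of_real.hom_prod_list o_def)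
  finally have "char_poly A = (\<Prod>a\<leftarrow>map Re as. [:- a, 1:])"
    by (rule map_poly_of_real.injectivity)
  then show ?thesis by (rule that)
qed

text \<open>This is the Gram-Schmidt process started at \<open>v\<close>, followed by a normalization of the columns,
  so that the inverse of \<open>W\<close> is its transpose and conjugation by \<open>W\<close> preserves symmetry.\<close>

lemma orthogonal_mat_with_first_column:
  fixes v :: "real vec"
  assumes v: "v \<in> carrier_vec n" and v0: "v \<noteq> 0\<^sub>v n"
  obtains W c where "W \<in> carrier_mat n n" "transpose_mat W * W = 1\<^sub>m n" "col W 0 = c \<cdot>\<^sub>v v"
proof -
  interpret cof_vec_space n "TYPE(real)" .
  define b where "b = basis_completion v"
  define ws where "ws = gram_schmidt n b"
  from basis_completion[OF v v0, folded b_def]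
  have b: "distinct b" "\<not> lin_dep (set b)" "set b \<subseteq> carrier_vec n" "hd b = v" "length b = n"
    by auto
  from gram_schmidt_result[OF b(3) b(1) b(2) refl, folded ws_def]
  have ws: "set ws \<subseteq> carrier_vec n" "corthogonal ws" "length ws = n"
    by (auto simp: b)
  have n: "n \<noteq> 0"
  proof
    assume "n = 0"
    with v v0 show False by auto
  qed
  with b obtain vs where bv: "b = v # vs" by (cases b) auto
  have hd: "hd ws = v" using gram_schmidt_hd[OF v, of vs] by (simp add: ws_def bv)
  have wsn: "ws ! i \<in> carrier_vec n" if "i < n" for i using ws that by auto
  define u where "u i = (1 / sqrt (ws ! i \<bullet> ws ! i)) \<cdot>\<^sub>v ws ! i" for i
  define W where "W = mat n n (\<lambda>(x, i). u i $ x)"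
  have W: "W \<in> carrier_mat n n" by (simp add: W_def)
  have col: "col W i = u i" if "i < n" for i
    using that wsn[OF that] by (intro eq_vecI) (auto simp: W_def u_def)
  have pos: "ws ! i \<bullet> ws ! i > 0" if "i < n" for i
    using conjugate_square_greater_0_vec[OF wsn[OF that]] corthogonalD[OF ws(2), of i i] that ws(3)
      wsn[OF that] by (auto simp: less_le)
  have "transpose_mat W * W = 1\<^sub>m n"
  proof (rule eq_matI)
    fix i j assume ij: "i < dim_row (1\<^sub>m n :: real mat)" "j < dim_col (1\<^sub>m n :: real mat)"
    then have "i < n" "j < n" by auto
    have "(transpose_mat W * W) $$ (i, j) = u i \<bullet> u j"
      using W \<open>i < n\<close> \<open>j < n\<close> by (simp add: col)
    also have "\<dots> = (ws ! i \<bullet> ws ! j) / (sqrt (ws ! i \<bullet> ws ! i) * sqrt (ws ! j \<bullet> ws ! j))"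
      using wsn[OF \<open>i < n\<close>] wsn[OF \<open>j < n\<close>] by (simp add: u_def)
    also have "\<dots> = (1\<^sub>m n :: real mat) $$ (i, j)"
      using pos[OF \<open>i < n\<close>] corthogonalD[OF ws(2), of i j] \<open>i < n\<close> \<open>j < n\<close> ws(3) by auto
    finally show "(transpose_mat W * W) $$ (i, j) = (1\<^sub>m n :: real mat) $$ (i, j)" .
  qed (use W in auto)
  moreover have "col W 0 = (1 / sqrt (ws ! 0 \<bullet> ws ! 0)) \<cdot>\<^sub>v v"
    using col[of 0] hd n ws(3) by (cases ws) (auto simp: u_def)
  ultimately show ?thesis using W that by blast
qed

text \<open>Deflation: conjugating by an orthogonal matrix whose first column is an eigenvector for the
  first listed root splits off a \<open>1 \<times> 1\<close> block. By symmetry the rest of the first row vanishes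
  along with the first column, so the remaining block is again symmetric, and its characteristic
  polynomial is the product over the remaining roots.\<close>

lemma symmetric_real_mat_diagonalization:
  fixes A :: "real mat"
  assumes "A \<in> carrier_mat n n" and "transpose_mat A = A"
    and "char_poly A = (\<Prod>e\<leftarrow>es. [:- e, 1:])"
  shows "\<exists>P \<in> carrier_mat n n. transpose_mat P * P = 1\<^sub>m n \<and>
           A * P = P * mat n n (\<lambda>(i, j). if i = j then es ! i else 0)"
  using assms
proof (induction es arbitrary: n A)
  case Nil
  then have "n = 0" using degree_monic_char_poly[of A n] by simp
  with Nil show ?case by (intro bexI[of _ "1\<^sub>m 0"]) auto
next
  case (Cons e es)
  note A = Cons.prems(1) and sym = Cons.prems(2)
  note square = assoc_mult_mat[where n\<^sub>1=n and n\<^sub>2=n and n\<^sub>3=n and n\<^sub>4=n] mult_carrier_mat[where n=n]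
  have "eigenvalue A e" unfolding eigenvalue_root_char_poly[OF A] Cons.prems(3) by simp
  then obtain v where v: "v \<in> carrier_vec n" "v \<noteq> 0\<^sub>v n" and Av: "A *\<^sub>v v = e \<cdot>\<^sub>v v"
    using A by (auto simp: eigenvalue_def eigenvector_def)
  from orthogonal_mat_with_first_column[OF v] obtain W c where W: "W \<in> carrier_mat n n"
    and WW: "transpose_mat W * W = 1\<^sub>m n" and Wv: "col W 0 = c \<cdot>\<^sub>v v" .
  have WW': "W * transpose_mat W = 1\<^sub>m n"
    using mat_mult_left_right_inverse[OF _ W WW] W by simp
  have WT: "transpose_mat W \<in> carrier_mat n n" using W by simp
  obtain m where n: "n = Suc m" using v by (cases n) auto
  define B where "B = transpose_mat W * A * W"
  have B: "B \<in> carrier_mat n n" using W A by (simp add: B_def)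
  have AW: "A * W = W * B"
  proof -
    have "W * B = (W * transpose_mat W) * (A * W)"
      unfolding B_def using A W WT by (simp add: square)
    then show ?thesis using WW' A W by (simp add: mult_carrier_mat[where n=n])
  qed
  have symB: "transpose_mat B = B"
    unfolding B_def using A W WT sym
    by (simp add: transpose_mult[where nr=n and n=n and nc=n] square)
  have symB': "B $$ (i, j) = B $$ (j, i)" if "i < n" "j < n" for i j
    using B that by (metis symB carrier_matD index_transpose_mat(1))
  have B0: "B $$ (i, 0) = (if i = 0 then e else 0)" if "i < n" for i
  proof -
    have "B = transpose_mat W * (A * W)" unfolding B_def using A W WT by (simp add: assoc_mult_mat)
    then have "B $$ (i, 0) = col W i \<bullet> col (A * W) 0"
      using that n W A by simp
    also have "col (A * W) 0 = A *\<^sub>v col W 0"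
      by (rule col_mult2[OF A W]) (simp add: n)
    also have "\<dots> = e \<cdot>\<^sub>v col W 0"
      unfolding Wv using A v by (simp add: mult_mat_vec[OF A v(1)] Av smult_smult_assoc mult.commute)
    also have "col W i \<bullet> (e \<cdot>\<^sub>v col W 0) = e * (col W i \<bullet> col W 0)"
      using W by (simp add: scalar_prod_smult_distrib[where n=n])
    also have "col W i \<bullet> col W 0 = (transpose_mat W * W) $$ (i, 0)"
      using that n W by simp
    finally show ?thesis using that n by (simp add: WW)
  qed
  define A3 where "A3 = mat m m (\<lambda>(i, j). B $$ (Suc i, Suc j))"
  have A3: "A3 \<in> carrier_mat m m" by (simp add: A3_def)
  have Bblock: "B = four_block_mat (mat 1 1 (\<lambda>_. e)) (0\<^sub>m 1 m) (0\<^sub>m m 1) A3"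
    using B n B0 symB'[of 0] by (intro eq_matI) (auto simp: A3_def)
  have "similar_mat_wit B A (transpose_mat W) W"
    using A B W WT WW WW' by (intro similar_mat_witI[of _ _ n]) (auto simp: B_def)
  then have "similar_mat B A" unfolding similar_mat_def by blast
  from char_poly_similar[OF this]
  have "char_poly B = [:- e, 1:] * (\<Prod>e\<leftarrow>es. [:- e, 1:])" using Cons.prems(3) by simp
  moreover have "char_poly B = char_poly (mat 1 1 (\<lambda>_. e)) * char_poly A3"
    unfolding Bblock by (rule char_poly_four_block_zeros_col) (use A3 in auto)
  moreover have "char_poly (mat 1 1 (\<lambda>_. e)) = [:- e, 1:]"
    by (simp add: char_poly_defs det_def sign_def)
  ultimately have "[:- e, 1:] * char_poly A3 = [:- e, 1:] * (\<Prod>e\<leftarrow>es. [:- e, 1:])" by simp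
  then have cp3: "char_poly A3 = (\<Prod>e\<leftarrow>es. [:- e, 1:])"
    by (metis mult_cancel_left pCons_eq_0_iff zero_neq_one)
  have "transpose_mat A3 = A3"
    using symB' n by (intro eq_matI) (auto simp: A3_def)
  from Cons.IH[OF A3 this cp3] obtain Q where Q: "Q \<in> carrier_mat m m"
    and QQ: "transpose_mat Q * Q = 1\<^sub>m m"
    and AQ: "A3 * Q = Q * mat m m (\<lambda>(i, j). if i = j then es ! i else 0)" by blast
  define D where "D = mat n n (\<lambda>(i, j). if i = j then (e # es) ! i else 0)"
  define D3 where "D3 = mat m m (\<lambda>(i, j). if i = j then es ! i else 0)"
  have D: "D \<in> carrier_mat n n" "D3 \<in> carrier_mat m m" by (simp_all add: D_def D3_def)
  have Dblock: "D = four_block_mat (mat 1 1 (\<lambda>_. e)) (0\<^sub>m 1 m) (0\<^sub>m m 1) D3"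
    using n by (intro eq_matI) (auto simp: D_def D3_def)
  define F where "F = four_block_mat (1\<^sub>m 1) (0\<^sub>m 1 m) (0\<^sub>m m 1) Q"
  have F: "F \<in> carrier_mat n n"
    using four_block_carrier_mat[of "1\<^sub>m 1" 1 1 Q m m] Q n by (simp add: F_def)
  have FT: "transpose_mat F = four_block_mat (1\<^sub>m 1) (0\<^sub>m 1 m) (0\<^sub>m m 1) (transpose_mat Q)"
    unfolding F_def using Q by (subst transpose_four_block_mat[of _ 1 1 _ m _ m]) auto
  have FF: "transpose_mat F * F = 1\<^sub>m n"
    unfolding FT unfolding F_def using Q n
    by (subst mult_four_block_mat[of _ 1 1 _ m _ m _ _ 1 _ m])
      (auto simp: QQ)
  have e1: "mat 1 1 (\<lambda>_. e) * 1\<^sub>m 1 = mat 1 1 (\<lambda>_. e)" "1\<^sub>m 1 * mat 1 1 (\<lambda>_. e) = mat 1 1 (\<lambda>_. e)"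
    by auto
  have BF: "B * F = F * D"
  proof -
    have "B * F = four_block_mat (mat 1 1 (\<lambda>_. e)) (0\<^sub>m 1 m) (0\<^sub>m m 1) (A3 * Q)"
      unfolding Bblock F_def using Q A3
      by (subst mult_four_block_mat[of _ 1 1 _ m _ m _ _ 1 _ m])
        (auto simp: e1)
    moreover have "F * D = four_block_mat (mat 1 1 (\<lambda>_. e)) (0\<^sub>m 1 m) (0\<^sub>m m 1) (Q * D3)"
      unfolding Dblock F_def using Q D
      by (subst mult_four_block_mat[of _ 1 1 _ m _ m _ _ 1 _ m])
        (auto simp: e1)
    ultimately show ?thesis using AQ by (simp add: D3_def)
  qed
  have "transpose_mat (W * F) * (W * F) = transpose_mat F * (transpose_mat W * W) * F"
    using W F WT by (simp add: transpose_mult[where nr=n and n=n and nc=n] square)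
  then have "transpose_mat (W * F) * (W * F) = 1\<^sub>m n"
    using F by (simp add: WW FF)
  moreover have "A * (W * F) = (W * F) * D"
  proof -
    have "A * (W * F) = (A * W) * F" using A W F by simp
    also have "\<dots> = W * (B * F)" unfolding AW using W B F by simp
    also have "\<dots> = (W * F) * D" unfolding BF using W F D by simp
    finally show ?thesis .
  qed
  ultimately show ?case unfolding D_def
    by (intro bexI[of _ "W * F"]) (use W F in auto)
qed

section \<open>Eigenbasis in the order of the eigenvalues\<close>

lemma symmetric_real_mat_eigval_list:
  fixes A :: "real mat"
  assumes A: "A \<in> carrier_mat n n" and sym: "transpose_mat A = A"
  defines "es \<equiv> map (\<lambda>i. eigval A (Suc i)) [0..<n]"
  shows "char_poly A = (\<Prod>e\<leftarrow>es. [:- e, 1:])" and "sorted (rev es)"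
proof -
  obtain as where as: "char_poly A = (\<Prod>a\<leftarrow>as. [:- a, 1:])"
    using symmetric_real_mat_char_poly_splits[OF A sym] .
  have "proots (\<Prod>a\<leftarrow>as. [:- a, 1:]) = mset as"
    by (induction as) (simp_all add: proots_mult prod_list_zero_iff image_iff del: mult_pCons_left)
  then have proots: "proots (char_poly A) = mset as" by (simp add: as)
  have "degree (char_poly A) = length as"
    unfolding as by (rule degree_linear_factors)
  then have len: "length as = n" using degree_monic_char_poly[OF A] by simp
  have es: "es = rev (sorted_list_of_multiset (mset as))"
    using len by (intro nth_equalityI) (auto simp: es_def eigval_def proots)
  then show "sorted (rev es)" by simp
  have "mset es = mset as" by (simp add: es)
  then have "mset (map (\<lambda>e. [:- e, 1:]) es) = mset (map (\<lambda>e. [:- e, 1:]) as)" by simp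
  then show "char_poly A = (\<Prod>e\<leftarrow>es. [:- e, 1:])"
    unfolding as by (metis prod_mset_prod_list)
qed

lemma symmetric_real_mat_eigval_antimono:
  fixes A :: "real mat"
  assumes A: "A \<in> carrier_mat n n" and sym: "transpose_mat A = A"
    and ij: "i \<le> j" "j < n"
  shows "eigval A (Suc j) \<le> eigval A (Suc i)"
proof -
  have "sorted_wrt (\<ge>) (map (\<lambda>i. eigval A (Suc i)) [0..<n])"
    using symmetric_real_mat_eigval_list(2)[OF A sym] by (simp only: sorted_wrt_rev)
  then show ?thesis
    using ij by (cases "i = j") (auto simp: sorted_wrt_iff_nth_less)
qed

text \<open>The spectral theorem in coordinates: orthonormality, completeness and the spectral
  decomposition. The function \<open>f i\<close>, counted from \<open>0\<close>, belongs to the eigenvalue of number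
  \<open>Suc i\<close>.\<close>

lemma symmetric_real_mat_eigenbasis:
  fixes A :: "real mat"
  assumes A: "A \<in> carrier_mat n n" and sym: "transpose_mat A = A"
  obtains f :: "nat \<Rightarrow> nat \<Rightarrow> real"
  where "\<forall>i<n. \<forall>j<n. (\<Sum>x<n. f i x * f j x) = (if i = j then 1 else 0)"
    and "\<forall>x<n. \<forall>y<n. (\<Sum>i<n. f i x * f i y) = (if x = y then 1 else 0)"
    and "\<forall>x<n. \<forall>y<n. A $$ (x, y) = (\<Sum>i<n. eigval A (Suc i) * (f i x * f i y))"
proof -
  let ?es = "map (\<lambda>i. eigval A (Suc i)) [0..<n]"
  define D where "D = mat n n (\<lambda>(i, j). if i = j then ?es ! i else 0)"
  obtain P where P: "P \<in> carrier_mat n n" and PP: "transpose_mat P * P = 1\<^sub>m n"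
    and AP: "A * P = P * D"
    using symmetric_real_mat_diagonalization[OF A sym symmetric_real_mat_eigval_list(1)[OF A sym]]
    by (auto simp: D_def)
  have PT: "transpose_mat P \<in> carrier_mat n n" using P by simp
  have PP': "P * transpose_mat P = 1\<^sub>m n" by (rule mat_mult_left_right_inverse[OF PT P PP])
  have D: "D \<in> carrier_mat n n" by (simp add: D_def)
  have "A = A * (P * transpose_mat P)" using A PP' by simp
  also have "\<dots> = P * D * transpose_mat P" using A P PT by (simp add: AP flip: assoc_mult_mat)
  finally have A_eq: "A = P * D * transpose_mat P" .
  have PD: "(P * D) $$ (x, i) = P $$ (x, i) * eigval A (Suc i)" if "x < n" "i < n" for x i
    using that P by (simp add: scalar_prod_def D_def if_distrib sum.delta cong: if_cong)
  show ?thesis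
  proof (rule that[of "\<lambda>i x. P $$ (x, i)"]; intro allI impI)
    fix i j assume ij: "i < n" "j < n"
    have "(\<Sum>x<n. P $$ (x, i) * P $$ (x, j)) = (transpose_mat P * P) $$ (i, j)"
      using ij P by (simp add: scalar_prod_def lessThan_atLeast0)
    then show "(\<Sum>x<n. P $$ (x, i) * P $$ (x, j)) = (if i = j then 1 else 0)"
      using ij by (simp add: PP)
  next
    fix x y assume xy: "x < n" "y < n"
    have "(\<Sum>i<n. P $$ (x, i) * P $$ (y, i)) = (P * transpose_mat P) $$ (x, y)"
      using xy P by (simp add: scalar_prod_def lessThan_atLeast0)
    then show "(\<Sum>i<n. P $$ (x, i) * P $$ (y, i)) = (if x = y then 1 else 0)"
      using xy by (simp add: PP')
  next
    fix x y assume xy: "x < n" "y < n"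
    have "A $$ (x, y) = (\<Sum>i<n. (P * D) $$ (x, i) * P $$ (y, i))"
      using xy P D
      by (subst A_eq, subst index_mult_mat(1)[of x "P * D"])
        (simp_all add: scalar_prod_def lessThan_atLeast0 row_def)
    then show "A $$ (x, y) = (\<Sum>i<n. eigval A (Suc i) * (P $$ (x, i) * P $$ (y, i)))"
      using xy by (simp add: PD mult_ac)
  qed
qed

section \<open>Eigenvalue sums of properly colored matrices\<close>

text \<open>With \<open>b\<close> the extremal weights, which are \<open>c\<close> on the last \<open>m\<close> indices and \<open>0\<close> elsewhere, and
  \<open>t\<close> the largest of the last \<open>m\<close> values, the factors \<open>w j - b j\<close> and \<open>l j - t\<close> never have
  opposite signs. Subtracting \<open>t\<close> does not change the comparison because \<open>w\<close> and \<open>b\<close> have the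
  same total.\<close>

lemma weighted_sum_ge_smallest_terms:
  fixes l w :: "nat \<Rightarrow> real" and c :: real
  assumes anti: "\<And>i j. i \<le> j \<Longrightarrow> j < n \<Longrightarrow> l j \<le> l i"
    and w: "\<And>j. j < n \<Longrightarrow> 0 \<le> w j" "\<And>j. j < n \<Longrightarrow> w j \<le> c"
    and total: "(\<Sum>j<n. w j) = c * real m"
    and m: "1 \<le> m" "m \<le> n"
  shows "c * (\<Sum>j\<in>{n-m..<n}. l j) \<le> (\<Sum>j<n. w j * l j)"
proof -
  define t where "t = l (n - m)"
  define b where "b j = (if n - m \<le> j then c else 0)" for j
  have split: "(\<Sum>j<n. b j * g j) = c * (\<Sum>j\<in>{n-m..<n}. g j)" for g
  proof -
    have "(\<Sum>j\<in>{n-m..<n}. c * g j) = (\<Sum>j<n. b j * g j)"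
      by (rule sum.mono_neutral_cong_left) (auto simp: b_def)
    then show ?thesis by (simp add: sum_distrib_left)
  qed
  have "0 \<le> (\<Sum>j<n. (w j - b j) * (l j - t))"
  proof (rule sum_nonneg)
    fix j assume "j \<in> {..<n}"
    then have j: "j < n" by simp
    show "0 \<le> (w j - b j) * (l j - t)"
    proof (cases "n - m \<le> j")
      case True
      then show ?thesis using w(2)[OF j] anti[OF True j]
        by (simp add: b_def t_def mult_nonpos_nonpos)
    next
      case False
      then show ?thesis using w(1)[OF j] anti[of j "n - m"] m
        by (simp add: b_def t_def)
    qed
  qed
  also have "\<dots> = (\<Sum>j<n. w j * l j) - (\<Sum>j<n. b j * l j)
      - ((\<Sum>j<n. w j) - (\<Sum>j<n. b j * 1)) * t"
    by (simp add: algebra_simps sum.distrib sum_subtractf sum_distrib_left sum_distrib_right)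
  also have "(\<Sum>j<n. b j * 1) = c * real m"
    unfolding split using m by simp
  finally show ?thesis using total by (simp add: split)
qed

text \<open>The key inequality: the \<open>m\<close> largest eigenvalues are rewritten as minus a weighted sum of all
  eigenvalues, and the weights are the column sums \<open>w\<close> of the first \<open>m\<close> rows of \<open>q\<close>, as explained
  at the beginning.\<close>

lemma eigval_sums_of_properly_colored_mat:
  fixes A :: "real mat" and col :: "nat \<Rightarrow> 'c"
  assumes A: "A \<in> carrier_mat n n" and sym: "transpose_mat A = A"
    and fin: "finite C" and col: "\<And>x. x < n \<Longrightarrow> col x \<in> C"
    and zero: "\<And>x y. x < n \<Longrightarrow> y < n \<Longrightarrow> col x = col y \<Longrightarrow> A $$ (x, y) = 0"
    and m: "1 \<le> m" "m \<le> n"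
  shows "(\<Sum>i<m. eigval A (Suc i))
           \<le> (real (card C) - 1) * - (\<Sum>j\<in>{n-m..<n}. eigval A (Suc j))"
proof -
  obtain f :: "nat \<Rightarrow> nat \<Rightarrow> real"
    where orth': "\<forall>i<n. \<forall>j<n. (\<Sum>x<n. f i x * f j x) = (if i = j then 1 else 0)"
    and compl': "\<forall>x<n. \<forall>y<n. (\<Sum>i<n. f i x * f i y) = (if x = y then 1 else 0)"
    and spec': "\<forall>x<n. \<forall>y<n. A $$ (x, y) = (\<Sum>i<n. eigval A (Suc i) * (f i x * f i y))"
    using symmetric_real_mat_eigenbasis[OF A sym] .
  note orth = orth'[rule_format] and compl = compl'[rule_format] and spec = spec'[rule_format]
  define l where "l i = eigval A (Suc i)" for i
  define k where "k = real (card C)"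
  define K where "K a = {x. x < n \<and> col x = a}" for a
  have finK: "finite (K a)" for a by (simp add: K_def)
  have Kn: "x < n" if "x \<in> K a" for x a using that by (simp add: K_def)
  have classes: "(\<Sum>a\<in>C. \<Sum>x\<in>K a. g x) = (\<Sum>x<n. g x)" for g :: "nat \<Rightarrow> real"
    using sum.group[of "{..<n}" C col g] fin col by (auto simp: K_def)
  define s where "s i j a = (\<Sum>x\<in>K a. f i x * f j x)" for i j a
  define q where "q i j = k * (\<Sum>a\<in>C. (s i j a)\<^sup>2) - (if i = j then 1 else 0)" for i j
  have s_sum: "(\<Sum>a\<in>C. s i j a) = (if i = j then 1 else 0)" if "i < n" "j < n" for i j
    unfolding s_def classes by (rule orth[OF that])
  have s_sq: "(s i j a)\<^sup>2 = (\<Sum>x\<in>K a. \<Sum>y\<in>K a. (f i x * f i y) * (f j x * f j y))" for i j a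
    unfolding s_def power2_eq_square sum_product by (simp add: mult_ac)
  have q_nonneg: "0 \<le> q i j" if "i < n" "j < n" for i j
  proof -
    have "(\<Sum>a\<in>C. s i j a)\<^sup>2 \<le> k * (\<Sum>a\<in>C. (s i j a)\<^sup>2)"
      using sum_squared_le_sum_of_squares[of "s i j" C] by (simp add: k_def mult.commute)
    then show ?thesis using s_sum[OF that] by (simp add: q_def split: if_splits)
  qed
  have q_sym: "q i j = q j i" for i j
    by (simp add: q_def s_def mult.commute)
  have q_col: "(\<Sum>i<n. q i j) = k - 1" if "j < n" for j
  proof -
    have "(\<Sum>i<n. (s i j a)\<^sup>2) = (\<Sum>x\<in>K a. f j x * f j x)" for a
    proof -
      have "(\<Sum>i<n. (s i j a)\<^sup>2)
          = (\<Sum>x\<in>K a. \<Sum>i<n. \<Sum>y\<in>K a. (f i x * f i y) * (f j x * f j y))"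
        unfolding s_sq by (rule sum.swap)
      also have "\<dots> = (\<Sum>x\<in>K a. \<Sum>y\<in>K a. (\<Sum>i<n. f i x * f i y) * (f j x * f j y))"
        unfolding sum_distrib_right by (intro sum.cong refl sum.swap)
      also have "\<dots> = (\<Sum>x\<in>K a. \<Sum>y\<in>K a. if x = y then f j x * f j x else 0)"
        by (intro sum.cong refl) (auto simp: compl dest!: Kn)
      also have "\<dots> = (\<Sum>x\<in>K a. f j x * f j x)" using finK by simp
      finally show ?thesis .
    qed
    then have "(\<Sum>i<n. \<Sum>a\<in>C. (s i j a)\<^sup>2) = (\<Sum>a\<in>C. \<Sum>x\<in>K a. f j x * f j x)"
      by (subst sum.swap) simp
    also have "\<dots> = 1" unfolding classes using orth[OF that that] by simp
    finally show ?thesis using that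
      by (simp add: q_def sum_subtractf flip: sum_distrib_left)
  qed
  \<comment> \<open>Summed over \<open>j\<close>, the spectral decomposition turns the squares into entries of \<open>A\<close> between
    two vertices of equal color.\<close>
  have q_l: "(\<Sum>j<n. q i j * l j) = - l i" if "i < n" for i
  proof -
    have "(\<Sum>j<n. (s i j a)\<^sup>2 * l j) = 0" for a
    proof -
      have "(\<Sum>j<n. (s i j a)\<^sup>2 * l j)
          = (\<Sum>j<n. \<Sum>x\<in>K a. \<Sum>y\<in>K a. (f i x * f i y) * (l j * (f j x * f j y)))"
        unfolding s_sq sum_distrib_right by (intro sum.cong refl) (simp add: mult_ac)
      also have "\<dots> = (\<Sum>x\<in>K a. \<Sum>j<n. \<Sum>y\<in>K a. (f i x * f i y) * (l j * (f j x * f j y)))"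
        by (rule sum.swap)
      also have "\<dots> = (\<Sum>x\<in>K a. \<Sum>y\<in>K a. (f i x * f i y) * (\<Sum>j<n. l j * (f j x * f j y)))"
        unfolding sum_distrib_left by (intro sum.cong refl sum.swap)
      also have "\<dots> = (\<Sum>x\<in>K a. \<Sum>y\<in>K a. (f i x * f i y) * A $$ (x, y))"
        by (intro sum.cong refl) (simp add: spec l_def Kn)
      also have "\<dots> = 0"
        by (intro sum.neutral ballI) (simp add: zero K_def)
      finally show ?thesis .
    qed
    then have "(\<Sum>j<n. (\<Sum>a\<in>C. (s i j a)\<^sup>2) * l j) = 0"
      unfolding sum_distrib_right by (subst sum.swap) simp
    moreover have "(\<Sum>j<n. q i j * l j)
        = (\<Sum>j<n. k * ((\<Sum>a\<in>C. (s i j a)\<^sup>2) * l j) - (if i = j then l j else 0))"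
      by (intro sum.cong refl) (simp add: q_def algebra_simps)
    then have "(\<Sum>j<n. q i j * l j)
        = k * (\<Sum>j<n. (\<Sum>a\<in>C. (s i j a)\<^sup>2) * l j) - (\<Sum>j<n. if i = j then l j else 0)"
      by (simp only: sum_subtractf sum_distrib_left)
    ultimately show ?thesis using that by simp
  qed
  define w where "w j = (\<Sum>i<m. q i j)" for j
  have "(k - 1) * (\<Sum>j\<in>{n-m..<n}. l j) \<le> (\<Sum>j<n. w j * l j)"
  proof (rule weighted_sum_ge_smallest_terms)
    show "l j \<le> l i" if "i \<le> j" "j < n" for i j
      unfolding l_def by (rule symmetric_real_mat_eigval_antimono[OF A sym that])
    show "0 \<le> w j" if "j < n" for j
      unfolding w_def using that m by (intro sum_nonneg q_nonneg) auto
    show "w j \<le> k - 1" if "j < n" for j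
      unfolding w_def q_col[OF that, symmetric]
      by (rule sum_mono2) (use that m q_nonneg in auto)
    have "(\<Sum>j<n. w j) = (\<Sum>i<m. \<Sum>j<n. q j i)"
      unfolding w_def by (subst sum.swap) (simp add: q_sym)
    also have "\<dots> = (k - 1) * real m" using m by (simp add: q_col)
    finally show "(\<Sum>j<n. w j) = (k - 1) * real m" .
  qed (use m in auto)
  also have "(\<Sum>j<n. w j * l j) = (\<Sum>i<m. \<Sum>j<n. q i j * l j)"
    unfolding w_def sum_distrib_right by (rule sum.swap)
  also have "\<dots> = - (\<Sum>i<m. l i)"
    unfolding sum_negf[symmetric] using m by (intro sum.cong refl q_l) auto
  finally show ?thesis by (simp add: l_def k_def)
qed

text \<open>Dividing needs the sum \<open>B\<close> of the \<open>m\<close> smallest eigenvalues to be nonpositive. If \<open>B\<close> were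
  positive, the sum \<open>T\<close> of the \<open>m\<close> largest would be at least \<open>B > 0\<close>, while the inequality above
  bounds \<open>T\<close> by a nonpositive number. For \<open>B = 0\<close> the quotient is \<open>0\<close> by the convention on
  division by zero, and the bound holds since there is at least one color.\<close>

lemma eigval_ratio_of_properly_colored_mat:
  fixes A :: "real mat" and col :: "nat \<Rightarrow> 'c"
  assumes A: "A \<in> carrier_mat n n" and sym: "transpose_mat A = A"
    and fin: "finite C" and col: "\<And>x. x < n \<Longrightarrow> col x \<in> C"
    and zero: "\<And>x y. x < n \<Longrightarrow> y < n \<Longrightarrow> col x = col y \<Longrightarrow> A $$ (x, y) = 0"
    and m: "1 \<le> m" "m \<le> n"
  shows "(\<Sum>i<m. eigval A (Suc i)) / - (\<Sum>j\<in>{n-m..<n}. eigval A (Suc j)) \<le> real (card C) - 1"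
proof -
  define T where "T = (\<Sum>i<m. eigval A (Suc i))"
  define B where "B = (\<Sum>j\<in>{n-m..<n}. eigval A (Suc j))"
  have le: "T \<le> (real (card C) - 1) * - B"
    unfolding T_def B_def by (rule eigval_sums_of_properly_colored_mat[OF A sym fin col zero m])
  have "col 0 \<in> C" using col m by simp
  then have k: "real (card C) - 1 \<ge> 0"
    using fin card_gt_0_iff[of C] by (cases "card C") auto
  have "B = (\<Sum>i<m. eigval A (Suc (n - m + i)))"
    unfolding B_def using m
    by (intro sum.reindex_bij_witness[of _ "\<lambda>i. n - m + i" "\<lambda>j. j - (n - m)"]) auto
  also have "\<dots> \<le> T"
    unfolding T_def by (rule sum_mono) (rule symmetric_real_mat_eigval_antimono[OF A sym], use m in auto)
  finally have "B \<le> T" .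
  have "B \<le> 0"
  proof (rule ccontr)
    assume "\<not> B \<le> 0"
    then have "(real (card C) - 1) * - B \<le> 0" using k by (simp add: mult_nonneg_nonneg)
    with le \<open>B \<le> T\<close> \<open>\<not> B \<le> 0\<close> show False by linarith
  qed
  then have "T / - B \<le> real (card C) - 1"
    using le k by (cases "B = 0") (simp_all add: pos_divide_le_eq del: minus_mult_right mult_minus_right divide_minus_right)
  then show ?thesis by (simp add: T_def B_def)
qed

section \<open>Signed colorings\<close>

lemma card_color_set: "1 \<le> k \<Longrightarrow> card (color_set k) = k"
  by (cases "even k") (auto simp: color_set_def elim!: evenE oddE)

theorem theorem4p8:
  fixes S :: "'v sgraph" and vs :: "'v list" and n :: nat
  assumes "signed_graph S"
    and "card (verts S) = n"
    and "\<exists>e \<in> edges S. edge_sign S e = 1"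
    and "distinct vs" and "set vs = verts S"
  shows "real (signed_chromatic_number S) \<ge>
    1 + (MAX m \<in> {1..n - 1}.
           (\<Sum>i = 1..m. eigval (adj_matrix (positive_part S) vs) i) /
           (- (\<Sum>i = 1..m. eigval (adj_matrix (positive_part S) vs) (n - i + 1))))"
proof -
  define A where "A = adj_matrix (positive_part S) vs"
  define k where "k = signed_chromatic_number S"
  have len: "length vs = n" using assms(2,4,5) distinct_card by fastforce
  have A: "A \<in> carrier_mat n n" by (simp add: A_def adj_matrix_def len)
  have sym: "transpose_mat A = A"
    by (intro eq_matI) (auto simp: A_def adj_matrix_def insert_commute)
  have "k \<ge> 1 \<and> (\<exists>c. proper_coloring S k c)"
    unfolding k_def signed_chromatic_number_def
    by (rule LeastI_ex) (use ex_proper_coloring[OF assms(1)] in blast)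
  then obtain c where k: "k \<ge> 1" and c: "proper_coloring S k c" by blast
  have mem: "vs ! x \<in> verts S" if "x < n" for x using that len assms(5) nth_mem by metis
  \<comment> \<open>An edge has two ends, so the maximum is over a nonempty set.\<close>
  have n: "n \<ge> 2"
  proof -
    from assms(3) obtain e where "e \<in> edges S" by blast
    with assms(1) have "finite (verts S)" "e \<subseteq> verts S" "card e = 2"
      by (auto simp: signed_graph_def)
    then show ?thesis using assms(2) card_mono by metis
  qed
  have ratio: "(\<Sum>i = 1..m. eigval A i) / (- (\<Sum>i = 1..m. eigval A (n - i + 1))) \<le> real k - 1"
    if m: "m \<in> {1..n - 1}" for m
  proof -
    have "(\<Sum>i = 1..m. eigval A i) = (\<Sum>i<m. eigval A (Suc i))"
      by (intro sum.reindex_bij_witness[of _ Suc "\<lambda>i. i - 1"]) auto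
    moreover have "(\<Sum>i = 1..m. eigval A (n - i + 1)) = (\<Sum>j\<in>{n-m..<n}. eigval A (Suc j))"
      using m by (intro sum.reindex_bij_witness[of _ "\<lambda>j. n - j" "\<lambda>i. n - i"]) auto
    moreover have "(\<Sum>i<m. eigval A (Suc i)) / - (\<Sum>j\<in>{n-m..<n}. eigval A (Suc j))
        \<le> real (card (color_set k)) - 1"
    proof (rule eigval_ratio_of_properly_colored_mat[OF A sym])
      show "finite (color_set k)" by (simp add: color_set_def)
      show "c (vs ! x) \<in> color_set k" if "x < n" for x
        using c mem[OF that] by (auto simp: proper_coloring_def)
      show "A $$ (x, y) = 0" if "x < n" "y < n" "c (vs ! x) = c (vs ! y)" for x y
      proof (rule ccontr)
        assume "A $$ (x, y) \<noteq> 0"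
        with that have "{vs ! x, vs ! y} \<in> edges S" "edge_sign S {vs ! x, vs ! y} = 1"
          by (auto simp: A_def adj_matrix_def len positive_part_def split: if_splits)
        with c have "c (vs ! x) \<noteq> 1 * c (vs ! y)"
          unfolding proper_coloring_def by metis
        with that show False by simp
      qed
    qed (use m in auto)
    ultimately show ?thesis using card_color_set[OF k] by simp
  qed
  have "(MAX m \<in> {1..n - 1}. (\<Sum>i = 1..m. eigval A i) / (- (\<Sum>i = 1..m. eigval A (n - i + 1))))
      \<le> real k - 1"
    using n ratio by (intro Max.boundedI) auto
  then show ?thesis unfolding k_def A_def by linarith
qed

end
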